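(* Let $\mathcal{A}$ be a separated integral deformation of the braid arrangement in $V_{n-1}$ satisfying the weak triangle inequality, and let $D$ be a valid $m$-acyclic weighted digraph associated to $\mathcal{A}$. Let $\sigma$ be the total order of gains associated to $D$ and let $g$ be the gain function. Then, for each $i>1$ there is a directed path in $D$ from $\sigma(1)$ to $\sigma(i)$ such that all weights in the path are nonnegative and the total weight of the edges in the path is $g(\sigma(i))-g(\sigma(1))$.
   Context: $V_{n-1}=\{x\in\mathbb{R}^n: x_1+\cdots+x_n=0\}$. A deformation of the braid arrangement is the set of hyperplanes $x_i-x_j=a_{ij}^{(1)},\ldots,a_{ij}^{(n_{ij})}$ in $V_{n-1}$, $1\le i<j\le n$, where the $n_{ij}$ are nonnegative integers and $a_{ij}^{(1)}<\cdots<a_{ij}^{(n_{ij})}$ are real; put $A_{ij}=\{a_{ij}^{(1)},\ldots,a_{ij}^{(n_{ij})}\}$. It is separated if $0\in A_{ij}$ for all $i<j$, and integral if all $a_{ij}^{(k)}$ are integers. A weighted digraph on $\{1,\ldots,n\}$ is valid for a separated $\mathcal{A}$ if for each $i<j$ exactly one of the following holds: (a) there is no edge $i\rightarrow j$, and there is exactly one edge $j\rightarrow i$, of weight $-a_{ij}^{(1)}$; (b) there is exactly one edge $i\rightarrow j$, of weight $a_{ij}^{(k)}$, and exactly one edge $j\rightarrow i$, of weight $-a_{ij}^{(k+1)}$, for some $1\le k<n_{ij}$; (c) there is exactly one edge $i\rightarrow j$, of weight $a_{ij}^{(n_{ij})}$, and there is no edge $j\rightarrow i$. Write $w(i,j)$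 for the weight of the edge $i\rightarrow j$, with $w(i,j)=-\infty$ if there is no such edge. The digraph is $m$-acyclic if it contains no directed cycle of nonnegative total weight. $\mathcal{A}$ satisfies the weak triangle inequality if in every valid $m$-acyclic weighted digraph, for all triples $(i,j,k)$ of distinct vertices, $w(i,j)\ge 0$ and $w(j,k)\ge 0$ imply $w(i,k)\le w(i,j)+w(j,k)+1$. For a separated deformation and a valid $m$-acyclic weighted digraph $D$ there is a unique permutation $\sigma=\sigma(1)\cdots\sigma(n)$ of $\{1,\ldots,n\}$ with $w(\sigma(i),\sigma(j))\ge 0$ for all $i<j$; it is called the total order of gains of $D$. The gain function $g$ is defined by letting $g(\sigma(i))$ be the maximum total weight of a directed path in $D$ beginning at $\sigma(1)$ and ending at $\sigma(i)$; $g(\sigma(1))=0$. *)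

theory Defs
  imports
    "HOL-Combinatorics.Permutations"
    "HOL-Library.Extended_Real"
    "HOL-Library.FuncSet"
    "Graph_Theory.Arc_Walk"
begin

text \<open>
  Points of real n-space are functions on the index set \<open>{1..n}\<close>, extended by
  \<^const>\<open>undefined\<close> outside it, so that set equality of hyperplanes is the intended one.
\<close>

definition V :: "nat \<Rightarrow> (nat \<Rightarrow> real) set" where
  "V n = {x \<in> extensional {1..n}. (\<Sum>i = 1..n. x i) = 0}"

definition hyperplane :: "nat \<Rightarrow> nat \<Rightarrow> nat \<Rightarrow> real \<Rightarrow> (nat \<Rightarrow> real) set" where
  "hyperplane n i j a = {x \<in> V n. x i - x j = a}"

definition braid_deformation :: "nat \<Rightarrow> (nat \<Rightarrow> real) set set \<Rightarrow> bool" where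
  "braid_deformation n \<A> \<longleftrightarrow>
     (\<exists>A :: nat \<Rightarrow> nat \<Rightarrow> real set.
        (\<forall>i j. 1 \<le> i \<and> i < j \<and> j \<le> n \<longrightarrow> finite (A i j)) \<and>
        \<A> = {hyperplane n i j a | i j a. 1 \<le> i \<and> i < j \<and> j \<le> n \<and> a \<in> A i j})"

text \<open>
  The set $A_{ij}$ is read off from the arrangement; the lemma \<open>A_set_deformation\<close> below
  shows that this recovers the sets a deformation was built from.
\<close>

definition A_set :: "nat \<Rightarrow> (nat \<Rightarrow> real) set set \<Rightarrow> nat \<Rightarrow> nat \<Rightarrow> real set" where
  "A_set n \<A> i j = {a. hyperplane n i j a \<in> \<A>}"

definition n_count :: "nat \<Rightarrow> (nat \<Rightarrow> real) set set \<Rightarrow> nat \<Rightarrow> nat \<Rightarrow> nat" where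
  "n_count n \<A> i j = card (A_set n \<A> i j)"

text \<open>\<open>a_val n \<A> i j k\<close> is $a_{ij}^{(k)}$, numbered from \<open>k = 1\<close>; it is only meaningful for
  \<open>1 \<le> k \<le> n_count n \<A> i j\<close>.\<close>

definition a_val :: "nat \<Rightarrow> (nat \<Rightarrow> real) set set \<Rightarrow> nat \<Rightarrow> nat \<Rightarrow> nat \<Rightarrow> real" where
  "a_val n \<A> i j k = sorted_list_of_set (A_set n \<A> i j) ! (k - 1)"

definition separated :: "nat \<Rightarrow> (nat \<Rightarrow> real) set set \<Rightarrow> bool" where
  "separated n \<A> \<longleftrightarrow> (\<forall>i j. 1 \<le> i \<and> i < j \<and> j \<le> n \<longrightarrow> 0 \<in> A_set n \<A> i j)"

definition integral_deformation :: "nat \<Rightarrow> (nat \<Rightarrow> real) set set \<Rightarrow> bool" where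
  "integral_deformation n \<A> \<longleftrightarrow>
     (\<forall>i j. 1 \<le> i \<and> i < j \<and> j \<le> n \<longrightarrow> A_set n \<A> i j \<subseteq> \<int>)"

lemma hyperplane_inj:
  assumes ij: "1 \<le> i" "i < j" "j \<le> n" and kl: "1 \<le> k" "k < l" "l \<le> n"
    and eq: "hyperplane n i j a = hyperplane n k l b"
  shows "i = k \<and> j = l \<and> a = b"
proof -
  define e :: "nat \<Rightarrow> nat \<Rightarrow> real" where "e p q = (if q = p then 1 else 0)" for p q
  have sum_e: "(\<Sum>q = 1..n. e p q) = 1" if "1 \<le> p" "p \<le> n" for p
    using that by (simp add: e_def)
  define x where "x t m = restrict
      (\<lambda>q. a / 2 * e i q - a / 2 * e j q + t * (e i q + e j q - 2 * e m q)) {1..n}" for t m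
  have xV: "x t m \<in> V n" if "1 \<le> m" "m \<le> n" for t m
  proof -
    have "(\<Sum>q = 1..n. x t m q) =
        (\<Sum>q = 1..n. a / 2 * e i q - a / 2 * e j q + t * (e i q + e j q - 2 * e m q))"
      by (intro sum.cong) (auto simp: x_def)
    also have "\<dots> = a / 2 * (\<Sum>q = 1..n. e i q) - a / 2 * (\<Sum>q = 1..n. e j q)
        + t * ((\<Sum>q = 1..n. e i q) + (\<Sum>q = 1..n. e j q) - 2 * (\<Sum>q = 1..n. e m q))"
      by (simp only: sum.distrib sum_subtractf flip: sum_distrib_left)
    also have "\<dots> = 0"
      using that ij by (simp only: sum_e[of i] sum_e[of j] sum_e[of m]) simp
    finally show ?thesis by (simp add: V_def x_def)
  qed
  have xH: "x t m \<in> hyperplane n k l b" if "1 \<le> m" "m \<le> n" "m \<noteq> i" "m \<noteq> j" for t m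
  proof -
    have "x t m i - x t m j = a" using that ij by (simp add: x_def e_def)
    then show ?thesis unfolding eq[symmetric] using xV[of m t] that by (simp add: hyperplane_def)
  qed
  have same: "{i, j} = {k, l}"
  proof (rule ccontr)
    assume "{i, j} \<noteq> {k, l}"
    then obtain m where m: "m = k \<or> m = l" "m \<noteq> i" "m \<noteq> j"
      using ij(2) kl(2) by (metis insert_commute nat_neq_iff)
    then have "1 \<le> m" "m \<le> n" using kl by auto
    with m xH[of m 0] xH[of m 1] have
      "x 0 m k - x 0 m l = x 1 m k - x 1 m l" by (simp add: hyperplane_def)
    with m kl ij show False
      by (auto simp: x_def e_def split: if_splits)
  qed
  then have "i = k" "j = l" using ij(2) kl(2) by (auto simp: doubleton_eq_iff)
  moreover from this have "a = b"
  proof -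
    have "x 0 i \<in> hyperplane n i j a"
      using xV[of i 0] ij by (auto simp: hyperplane_def) (simp add: x_def e_def)
    moreover from this have "x 0 i \<in> hyperplane n k l b" using eq by simp
    ultimately show ?thesis using \<open>i = k\<close> \<open>j = l\<close> by (simp add: hyperplane_def)
  qed
  ultimately show ?thesis by simp
qed

lemma A_set_deformation:
  assumes "\<A> = {hyperplane n i j a | i j a. 1 \<le> i \<and> i < j \<and> j \<le> n \<and> a \<in> A i j}"
    and "1 \<le> i" "i < j" "j \<le> n"
  shows "A_set n \<A> i j = A i j"
  using assms hyperplane_inj[of i j n] unfolding A_set_def by blast

text \<open>
  A weighted digraph on \<open>{1..n}\<close> is given by its set of edges; the edge from \<open>i\<close> to \<open>j\<close> of
  weight \<open>a\<close> is the triple \<open>(i, a, j)\<close>.  Parallel edges of different weights are thus allowed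
  a priori; parallel edges of equal weight cannot be represented, but validity excludes
  parallel edges altogether.
\<close>

type_synonym wedge = "nat \<times> real \<times> nat"

definition edge_weight :: "wedge \<Rightarrow> real" where
  "edge_weight e = fst (snd e)"

definition digraph_of :: "nat \<Rightarrow> wedge set \<Rightarrow> (nat, wedge) pre_digraph" where
  "digraph_of n D = \<lparr>verts = {1..n}, arcs = D, tail = fst, head = (\<lambda>e. snd (snd e))\<rparr>"

definition weighted_digraph :: "nat \<Rightarrow> wedge set \<Rightarrow> bool" where
  "weighted_digraph n D \<longleftrightarrow> loopfree_digraph (digraph_of n D)"

definition weights :: "wedge set \<Rightarrow> nat \<Rightarrow> nat \<Rightarrow> real set" where
  "weights D i j = {a. (i, a, j) \<in> D}"

definition total_weight :: "wedge list \<Rightarrow> real" where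
  "total_weight p = sum_list (map edge_weight p)"

text \<open>
  The three alternatives are mutually exclusive, since they differ in which of the two edges
  between \<open>i\<close> and \<open>j\<close> are present, so the disjunction says that exactly one of them holds.
\<close>

definition valid :: "nat \<Rightarrow> (nat \<Rightarrow> real) set set \<Rightarrow> wedge set \<Rightarrow> bool" where
  "valid n \<A> D \<longleftrightarrow> weighted_digraph n D \<and>
     (\<forall>i j. 1 \<le> i \<and> i < j \<and> j \<le> n \<longrightarrow>
        (weights D i j = {} \<and> weights D j i = {- a_val n \<A> i j 1}) \<or>
        (\<exists>k. 1 \<le> k \<and> k < n_count n \<A> i j \<and>
           weights D i j = {a_val n \<A> i j k} \<and>
           weights D j i = {- a_val n \<A> i j (k + 1)}) \<or>
        (weights D i j = {a_val n \<A> i j (n_count n \<A> i j)} \<and> weights D j i = {}))"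

definition w :: "wedge set \<Rightarrow> nat \<Rightarrow> nat \<Rightarrow> ereal" where
  "w D i j = (if weights D i j = {} then - \<infinity> else ereal (THE a. a \<in> weights D i j))"

definition m_acyclic :: "nat \<Rightarrow> wedge set \<Rightarrow> bool" where
  "m_acyclic n D \<longleftrightarrow>
     \<not> (\<exists>p. pre_digraph.cycle (digraph_of n D) p \<and> 0 \<le> total_weight p)"

definition weak_triangle_inequality :: "nat \<Rightarrow> (nat \<Rightarrow> real) set set \<Rightarrow> bool" where
  "weak_triangle_inequality n \<A> \<longleftrightarrow>
     (\<forall>D. valid n \<A> D \<and> m_acyclic n D \<longrightarrow>
        (\<forall>i\<in>{1..n}. \<forall>j\<in>{1..n}. \<forall>k\<in>{1..n}. i \<noteq> j \<and> j \<noteq> k \<and> i \<noteq> k \<longrightarrow>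
           0 \<le> w D i j \<and> 0 \<le> w D j k \<longrightarrow> w D i k \<le> w D i j + w D j k + 1))"

definition total_order_of_gains :: "nat \<Rightarrow> wedge set \<Rightarrow> (nat \<Rightarrow> nat) \<Rightarrow> bool" where
  "total_order_of_gains n D \<sigma> \<longleftrightarrow>
     \<sigma> permutes {1..n} \<and>
     (\<forall>i j. 1 \<le> i \<and> i < j \<and> j \<le> n \<longrightarrow> 0 \<le> w D (\<sigma> i) (\<sigma> j))"

text \<open>
  At \<open>v = \<sigma> 1\<close> the empty path is the only one, so the gain is 0 there.  For a valid \<open>D\<close> there are
  finitely many paths, and at least one to every vertex \<open>v\<close>, so the maximum exists.
\<close>

definition gain :: "nat \<Rightarrow> wedge set \<Rightarrow> (nat \<Rightarrow> nat) \<Rightarrow> nat \<Rightarrow> real" where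
  "gain n D \<sigma> v = Max {total_weight p | p. pre_digraph.apath (digraph_of n D) (\<sigma> 1) p v}"

end

theory Submission
  imports Defs
begin

text \<open>
  Call an edge of nonnegative weight a forward edge.  Since every directed cycle has negative
  total weight, a walk of forward edges never repeats a vertex; hence it suffices to show that
  every walk \<open>p\<close> starting at \<open>\<sigma> 1\<close> is dominated by a walk of forward edges, that is, one with
  the same ends and at least the same weight
  (\<open>forward_awalk_dominates\<close>).  Applied to a heaviest path this gives the theorem.

  The dominating walk is built edge by edge along \<open>p\<close>.  Let \<open>q\<close> be a walk of forward edges
  dominating the part of \<open>p\<close> read so far, and let \<open>b\<close> be the next edge, from \<open>j\<close> to \<open>k\<close>.  If \<open>b\<close>
  is a forward edge, append it.  If not, \<open>k\<close> precedes \<open>j\<close> in the total order of gains.  If \<open>q\<close>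
  passes through \<open>k\<close>, then the part of \<open>q\<close> after \<open>k\<close> forms a closed walk with \<open>b\<close>, whose weight is
  negative, so the part of \<open>q\<close> before \<open>k\<close> is already heavy enough.  Otherwise some edge
  \<open>u \<rightarrow> x\<close> of \<open>q\<close> jumps over \<open>k\<close>, so that \<open>u \<rightarrow> k\<close> and \<open>k \<rightarrow> x\<close> are forward edges.  The weak
  triangle inequality gives \<open>w(u,x) \<le> w(u,k) + w(k,x) + 1\<close>.  The closed walk consisting of
  \<open>k \<rightarrow> x\<close>, the part of \<open>q\<close> from \<open>x\<close> to \<open>j\<close>, and \<open>b\<close> has negative integral weight, so weight
  at most \<open>-1\<close>: integrality absorbs precisely the slack \<open>1\<close> of the weak inequality.  Hence
  following \<open>q\<close> to \<open>u\<close> and then taking \<open>u \<rightarrow> k\<close> loses nothing.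
\<close>

section \<open>Walks in digraphs without nonnegative cycles\<close>

context wf_digraph
begin

text \<open>
  A closed walk that is not a cycle splits at a repeated vertex into two shorter closed walks.
\<close>

lemma closed_awalk_weight_neg:
  fixes c :: "'b \<Rightarrow> real"
  assumes cyc: "\<And>p. cycle p \<Longrightarrow> sum_list (map c p) < 0"
    and "awalk u p u" "p \<noteq> []"
  shows "sum_list (map c p) < 0"
  using assms(2,3)
proof (induction "length p" arbitrary: u p rule: less_induct)
  case less
  show ?case
  proof (cases "distinct (tl (awalk_verts u p))")
    case True
    then show ?thesis using cyc less.prems unfolding cycle_def by blast
  next
    case False
    from less.prems obtain e p' where p: "p = e # p'" by (cases p) auto
    with less.prems have e: "e \<in> arcs G" "u = tail G e" "awalk (head G e) p' u"
      by (auto simp: awalk_Cons_iff)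
    with False p have "\<not> distinct (awalk_verts (head G e) p')" by simp
    with awalk_not_distinct_decomp[OF e(3)] obtain q r s x where
      qrs: "p' = q @ r @ s" "0 < length r"
        "awalk (head G e) q x" "awalk x r x" "awalk x s u" by blast
    have "awalk u (e # q @ s) u"
      using e(1,2) awalk_appendI[OF qrs(3,5)] by (simp add: awalk_Cons_iff)
    with less.hyps[of "e # q @ s" u] qrs p have "sum_list (map c (e # q @ s)) < 0" by simp
    moreover from less.hyps[of r x] qrs p have "sum_list (map c r) < 0" by simp
    ultimately show ?thesis using p qrs(1) by simp
  qed
qed

lemma awalk_snocI:
  assumes "awalk u p (tail G e)" "e \<in> arcs G"
  shows "awalk u (p @ [e]) (head G e)"
  using awalk_appendI[OF assms(1) arc_implies_awalk[OF assms(2)]] .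

lemma awalk_exit_edge:
  assumes "awalk u p v" "P u" "\<not> P v"
  obtains q e r where "p = q @ e # r" "e \<in> arcs G" "awalk u q (tail G e)"
    "awalk (head G e) r v" "P (tail G e)" "\<not> P (head G e)"
proof -
  have "\<exists>q e r. p = q @ e # r \<and> e \<in> arcs G \<and> awalk u q (tail G e) \<and>
    awalk (head G e) r v \<and> P (tail G e) \<and> \<not> P (head G e)"
    using assms
  proof (induction p arbitrary: u)
    case Nil
    then show ?case by (simp add: awalk_Nil_iff)
  next
    case (Cons e p)
    then have e: "e \<in> arcs G" "u = tail G e" "awalk (head G e) p v"
      by (auto simp: awalk_Cons_iff)
    show ?case
    proof (cases "P (head G e)")
      case True
      from Cons.IH[OF e(3) True Cons.prems(3)] obtain q f r where
        "p = q @ f # r" "f \<in> arcs G" "awalk (head G e) q (tail G f)"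
        "awalk (head G f) r v" "P (tail G f)" "\<not> P (head G f)" by blast
      with e show ?thesis
        by (intro exI[of _ "e # q"] exI[of _ f] exI[of _ r]) (simp add: awalk_Cons_iff)
    next
      case False
      with e Cons.prems show ?thesis
        by (intro exI[of _ "[]"] exI[of _ e] exI[of _ p]) (simp add: awalk_Nil_iff)
    qed
  qed
  with that show thesis by blast
qed

section \<open>Dominating a walk by a walk of nonnegative edges\<close>

text \<open>
  The hypotheses record what is needed from the total order of gains: any two vertices are
  joined by a forward edge, and \<open>s\<close> precedes all other vertices.  The bound \<open>-1\<close> on closed walks
  is where integrality enters; it cancels the \<open>+ 1\<close> of the triangle hypothesis.  The order itself
  is not mentioned: the edge of a walk that jumps over a vertex \<open>v\<close> is found as the place where
  the walk leaves the set of vertices with a forward edge to \<open>v\<close>.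
\<close>

lemma forward_awalk_dominates:
  fixes c :: "'b \<Rightarrow> real"
  assumes closed: "\<And>u p. awalk u p u \<Longrightarrow> p \<noteq> [] \<Longrightarrow> sum_list (map c p) \<le> - 1"
    and comparable: "\<And>u v. u \<in> verts G \<Longrightarrow> v \<in> verts G \<Longrightarrow> u \<noteq> v \<Longrightarrow>
      \<exists>e\<in>arcs G. 0 \<le> c e \<and> (tail G e = u \<and> head G e = v \<or> tail G e = v \<and> head G e = u)"
    and source: "\<And>v. v \<in> verts G \<Longrightarrow> v \<noteq> s \<Longrightarrow>
      \<exists>e\<in>arcs G. 0 \<le> c e \<and> tail G e = s \<and> head G e = v"
    and triangle: "\<And>e f h. e \<in> arcs G \<Longrightarrow> f \<in> arcs G \<Longrightarrow> h \<in> arcs G \<Longrightarrow>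
      tail G e = tail G h \<Longrightarrow> head G e = tail G f \<Longrightarrow> head G f = head G h \<Longrightarrow>
      0 \<le> c e \<Longrightarrow> 0 \<le> c f \<Longrightarrow> c h \<le> c e + c f + 1"
    and "awalk s p v"
  shows "\<exists>q. awalk s q v \<and> (\<forall>e\<in>set q. 0 \<le> c e) \<and> sum_list (map c p) \<le> sum_list (map c q)"
  using assms(5)
proof (induction p arbitrary: v rule: rev_induct)
  case Nil
  then show ?case by (intro exI[of _ "[]"]) simp
next
  case (snoc b p)
  define j where "j = tail G b"
  from snoc.prems have sp: "awalk s p j" and b: "b \<in> arcs G" "head G b = v"
    by (auto simp: j_def awalk_Cons_iff awalk_Nil_iff)
  from snoc.IH[OF sp] obtain q where
    q: "awalk s q j" "\<forall>e\<in>set q. 0 \<le> c e" "sum_list (map c p) \<le> sum_list (map c q)" by blast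
  have v: "v \<in> verts G" and j: "j \<in> verts G" using b by (auto simp: j_def)
  have bw: "awalk j [b] v" using b j by (auto simp: j_def awalk_simps)
  define fwd where
    "fwd u x \<longleftrightarrow> (\<exists>e\<in>arcs G. 0 \<le> c e \<and> tail G e = u \<and> head G e = x)" for u x
  show ?case
  proof (cases "0 \<le> c b \<or> fwd j v")
    case True
    \<comment> \<open>If \<open>b\<close> is negative, then a forward edge parallel to it outweighs it.\<close>
    have "\<exists>f\<in>arcs G. 0 \<le> c f \<and> tail G f = j \<and> head G f = v \<and> c b \<le> c f"
    proof (cases "0 \<le> c b")
      case True
      with b show ?thesis by (auto simp: j_def)
    next
      case neg: False
      with True obtain f where "f \<in> arcs G" "0 \<le> c f" "tail G f = j" "head G f = v"
        by (auto simp: fwd_def)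
      with neg show ?thesis by force
    qed
    then obtain f where f: "f \<in> arcs G" "0 \<le> c f" "tail G f = j" "head G f = v" "c b \<le> c f"
      by blast
    then have "awalk j [f] v" using v by (auto simp: awalk_simps)
    with q(1) have "awalk s (q @ [f]) v" by (rule awalk_appendI)
    with f q show ?thesis by (intro exI[of _ "q @ [f]"]) auto
  next
    case False
    show ?thesis
    proof (cases "v = s")
      case True
      then have "awalk s (q @ [b]) s" using awalk_appendI[OF q(1) bw] by simp
      with closed[of s "q @ [b]"] q True show ?thesis
        by (intro exI[of _ "[]"]) (auto simp: awalk_Nil_iff v)
    next
      case vs: False
      have "fwd s v" using source[OF v vs] by (auto simp: fwd_def)
      moreover have "\<not> fwd j v" using False by simp
      ultimately obtain q1 h q2 where d: "q = q1 @ h # q2" "h \<in> arcs G"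
        "awalk s q1 (tail G h)" "awalk (head G h) q2 j" "fwd (tail G h) v" "\<not> fwd (head G h) v"
        by (rule awalk_exit_edge[OF q(1), where P = "\<lambda>u. fwd u v"])
      have rest: "awalk (head G h) (q2 @ [b]) v" using awalk_appendI[OF d(4) bw] .
      show ?thesis
      proof (cases "head G h = v")
        case True
        have "awalk s (q1 @ [h]) v"
          using awalk_snocI[OF d(3,2)] True by simp
        moreover have "sum_list (map c (q2 @ [b])) \<le> - 1"
          using rest True by (intro closed) auto
        ultimately show ?thesis using d(1) q(2,3)
          by (intro exI[of _ "q1 @ [h]"]) auto
      next
        case False
        with comparable[of "head G h" v] d(2,6) v obtain f where
          f: "f \<in> arcs G" "0 \<le> c f" "tail G f = v" "head G f = head G h"
          by (auto simp: fwd_def)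
        from d(5) obtain e where e: "e \<in> arcs G" "0 \<le> c e" "tail G e = tail G h" "head G e = v"
          by (auto simp: fwd_def)
        have "awalk v (f # q2 @ [b]) v" using f(1,3,4) rest
          by (simp add: awalk_Cons_iff del: awalk_append_iff)
        then have "c f + sum_list (map c q2) + c b \<le> - 1"
          using closed[of v "f # q2 @ [b]"] by simp
        moreover have "c h \<le> c e + c f + 1"
          using e f d(2) by (intro triangle) auto
        ultimately have "sum_list (map c (p @ [b])) \<le> sum_list (map c (q1 @ [e]))"
          using d(1) q(3) by simp
        moreover have "awalk s (q1 @ [e]) v"
          using awalk_snocI[of s q1 e] d(3) e by simp
        ultimately show ?thesis using e(2) d(1) q(2)
          by (intro exI[of _ "q1 @ [e]"]) auto
      qed
    qed
  qed
qed

end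

section \<open>Edge weights of valid digraphs\<close>

lemma digraph_of_simps [simp]:
  "verts (digraph_of n D) = {1..n}" "arcs (digraph_of n D) = D"
  "tail (digraph_of n D) e = fst e" "head (digraph_of n D) e = snd (snd e)"
  by (simp_all add: digraph_of_def)

lemma valid_loopfree: "valid n \<A> D \<Longrightarrow> loopfree_digraph (digraph_of n D)"
  by (simp add: valid_def weighted_digraph_def)

lemma valid_edge_ends:
  assumes "valid n \<A> D" "(u, a, v) \<in> D"
  shows "u \<in> {1..n}" "v \<in> {1..n}" "u \<noteq> v"
proof -
  interpret loopfree_digraph "digraph_of n D" using valid_loopfree[OF assms(1)] .
  show "u \<in> {1..n}" "v \<in> {1..n}" "u \<noteq> v"
    using tail_in_verts[of "(u, a, v)"] head_in_verts[of "(u, a, v)"] no_loops[of "(u, a, v)"]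
      assms(2) by auto
qed

lemma valid_weights_unique:
  assumes "valid n \<A> D" "(u, a, v) \<in> D"
  shows "weights D u v = {a}"
proof -
  note ends = valid_edge_ends[OF assms]
  have "a \<in> weights D u v" using assms(2) by (simp add: weights_def)
  moreover have "\<exists>b. weights D u v \<subseteq> {b}"
  proof (cases "u < v")
    case True
    with ends assms(1) show ?thesis
      unfolding valid_def by (metis atLeastAtMost_iff empty_subsetI order_refl)
  next
    case False
    with ends have "v < u" by simp
    with ends assms(1) show ?thesis
      unfolding valid_def by (metis atLeastAtMost_iff empty_subsetI order_refl)
  qed
  ultimately show ?thesis by auto
qed

lemma valid_w_edge:
  assumes "valid n \<A> D" "(u, a, v) \<in> D"
  shows "w D u v = ereal a"
  using valid_weights_unique[OF assms] by (simp add: w_def)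

lemma valid_w_nonneg_edge:
  assumes "valid n \<A> D" "0 \<le> w D u v"
  obtains a where "(u, a, v) \<in> D" "0 \<le> a"
proof -
  from assms(2) have "weights D u v \<noteq> {}" by (auto simp: w_def split: if_splits)
  then obtain a where a: "(u, a, v) \<in> D" by (auto simp: weights_def)
  with assms valid_w_edge[OF assms(1) a] have "0 \<le> a" by simp
  with a that show thesis by blast
qed

lemma finite_valid:
  assumes "valid n \<A> D"
  shows "finite D"
proof (rule finite_subset)
  show "D \<subseteq> (\<Union>u\<in>{1..n}. \<Union>v\<in>{1..n}. (\<lambda>a. (u, a, v)) ` weights D u v)"
  proof
    fix e assume "e \<in> D"
    moreover obtain u a v where e: "e = (u, a, v)" by (cases e)
    ultimately have D: "(u, a, v) \<in> D" by simp
    then have "a \<in> weights D u v" by (simp add: weights_def)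
    with valid_edge_ends[OF assms D] e
    show "e \<in> (\<Union>u\<in>{1..n}. \<Union>v\<in>{1..n}. (\<lambda>a. (u, a, v)) ` weights D u v)" by blast
  qed
next
  have "finite (weights D u v)" for u v
  proof (cases "weights D u v = {}")
    case False
    then obtain a where "(u, a, v) \<in> D" by (auto simp: weights_def)
    from valid_weights_unique[OF assms this] show ?thesis by simp
  qed simp
  then show "finite (\<Union>u\<in>{1..n}. \<Union>v\<in>{1..n}. (\<lambda>a. (u, a, v)) ` weights D u v)" by blast
qed

lemma finite_A_set:
  assumes "braid_deformation n \<A>" "1 \<le> i" "i < j" "j \<le> n"
  shows "finite (A_set n \<A> i j)"
proof -
  from assms(1) obtain A where A: "\<And>i j. 1 \<le> i \<and> i < j \<and> j \<le> n \<Longrightarrow> finite (A i j)"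
    "\<A> = {hyperplane n i j a | i j a. 1 \<le> i \<and> i < j \<and> j \<le> n \<and> a \<in> A i j}"
    unfolding braid_deformation_def by blast
  from A_set_deformation[OF A(2) assms(2-4)] A(1) assms(2-4) show ?thesis by simp
qed

lemma a_val_in_A_set:
  assumes "braid_deformation n \<A>" "1 \<le> i" "i < j" "j \<le> n" "1 \<le> k" "k \<le> n_count n \<A> i j"
  shows "a_val n \<A> i j k \<in> A_set n \<A> i j"
proof -
  from finite_A_set[OF assms(1-4)] have "set (sorted_list_of_set (A_set n \<A> i j)) = A_set n \<A> i j"
    "length (sorted_list_of_set (A_set n \<A> i j)) = n_count n \<A> i j"
    by (simp_all add: n_count_def)
  with assms(5,6) nth_mem[of "k - 1" "sorted_list_of_set (A_set n \<A> i j)"]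
  show ?thesis unfolding a_val_def by auto
qed

text \<open>
  Separation ensures \<open>n_count n \<A> i j \<ge> 1\<close>; without it the first and the last element of an empty
  \<open>A_set n \<A> i j\<close> would be arbitrary reals.
\<close>

lemma valid_edge_integral:
  assumes def: "braid_deformation n \<A>" and sep: "separated n \<A>"
    and int: "integral_deformation n \<A>" and val: "valid n \<A> D" and e: "(u, a, v) \<in> D"
  shows "a \<in> \<int>"
proof -
  have *: "x \<in> \<int> \<and> y \<in> \<int>"
    if ij: "1 \<le> i" "i < j" "j \<le> n" and x: "x \<in> insert 0 (weights D i j)"
      and y: "y \<in> insert 0 (weights D j i)" for i j x y
  proof -
    have "finite (A_set n \<A> i j)" using finite_A_set[OF def ij] .
    moreover from sep ij have "A_set n \<A> i j \<noteq> {}" by (auto simp: separated_def)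
    ultimately have pos: "1 \<le> n_count n \<A> i j" by (simp add: n_count_def Suc_le_eq card_gt_0_iff)
    have Z: "a_val n \<A> i j k \<in> \<int>" if "1 \<le> k" "k \<le> n_count n \<A> i j" for k
      using a_val_in_A_set[OF def ij that] int ij by (auto simp: integral_deformation_def)
    from val ij consider
        "weights D i j = {}" "weights D j i = {- a_val n \<A> i j 1}"
      | k where "1 \<le> k" "k < n_count n \<A> i j" "weights D i j = {a_val n \<A> i j k}"
          "weights D j i = {- a_val n \<A> i j (k + 1)}"
      | "weights D i j = {a_val n \<A> i j (n_count n \<A> i j)}" "weights D j i = {}"
      unfolding valid_def by blast
    then show ?thesis
    proof cases
      case 1
      with x y Z[of 1] pos show ?thesis by auto
    next
      case 2
      with x y Z[of k] Z[of "k + 1"] show ?thesis by auto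
    next
      case 3
      with x y Z[of "n_count n \<A> i j"] pos show ?thesis by auto
    qed
  qed
  have a: "a \<in> weights D u v" using e by (simp add: weights_def)
  show ?thesis
  proof (cases "u < v")
    case True
    with *[of u v a 0] a valid_edge_ends[OF val e] show ?thesis by auto
  next
    case False
    with *[of v u 0 a] a valid_edge_ends[OF val e] show ?thesis by auto
  qed
qed

section \<open>Heaviest paths from the first vertex\<close>

theorem theorem4p10:
  fixes n :: nat
    and \<A> :: "(nat \<Rightarrow> real) set set"
    and D :: "wedge set"
    and \<sigma> :: "nat \<Rightarrow> nat"
    and i :: nat
  assumes "braid_deformation n \<A>"
    and "separated n \<A>"
    and "integral_deformation n \<A>"
    and "weak_triangle_inequality n \<A>"
    and "valid n \<A> D"
    and "m_acyclic n D"
    and "total_order_of_gains n D \<sigma>"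
    and "1 < i" and "i \<le> n"
  shows "\<exists>p. pre_digraph.apath (digraph_of n D) (\<sigma> 1) p (\<sigma> i) \<and>
             (\<forall>e\<in>set p. 0 \<le> edge_weight e) \<and>
             total_weight p = gain n D \<sigma> (\<sigma> i) - gain n D \<sigma> (\<sigma> 1)"
proof -
  interpret loopfree_digraph "digraph_of n D" using valid_loopfree[OF assms(5)] .
  interpret fin_digraph "digraph_of n D"
    using finite_valid[OF assms(5)] by unfold_locales simp_all
  have perm: "\<sigma> permutes {1..n}"
    and ord: "\<And>a b. 1 \<le> a \<Longrightarrow> a < b \<Longrightarrow> b \<le> n \<Longrightarrow> 0 \<le> w D (\<sigma> a) (\<sigma> b)"
    using assms(7) by (auto simp: total_order_of_gains_def)
  have forward: "\<exists>e\<in>D. 0 \<le> edge_weight e \<and> fst e = \<sigma> a \<and> snd (snd e) = \<sigma> b"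
    if ab: "1 \<le> a" "a < b" "b \<le> n" for a b
  proof -
    obtain x where "(\<sigma> a, x, \<sigma> b) \<in> D" "0 \<le> x"
      using valid_w_nonneg_edge[OF assms(5) ord[OF ab]] .
    then show ?thesis by (intro bexI[of _ "(\<sigma> a, x, \<sigma> b)"]) (simp_all add: edge_weight_def)
  qed
  have closed: "sum_list (map edge_weight p) \<le> - 1" if p: "awalk u p u" "p \<noteq> []" for u p
  proof -
    have "sum_list (map edge_weight p) < 0"
    proof (rule closed_awalk_weight_neg[OF _ p])
      fix r assume "cycle r"
      with assms(6) show "sum_list (map edge_weight r) < 0"
        unfolding m_acyclic_def total_weight_def by (meson not_le)
    qed
    moreover have "\<forall>e\<in>set p. edge_weight e \<in> \<int>"
    proof
      fix e assume "e \<in> set p"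
      with p(1) have "(fst e, edge_weight e, snd (snd e)) \<in> D"
        by (auto simp: awalk_def edge_weight_def)
      then show "edge_weight e \<in> \<int>" by (rule valid_edge_integral[OF assms(1-3,5)])
    qed
    then have "sum_list (map edge_weight p) \<in> \<int>" by (induction p) auto
    then obtain z :: int where "sum_list (map edge_weight p) = of_int z" by (rule Ints_cases)
    ultimately show ?thesis by simp
  qed
  \<comment> \<open>A repeated vertex would cut out a closed walk of nonnegative weight.\<close>
  have apath: "apath u p v" if p: "awalk u p v" "\<forall>e\<in>set p. 0 \<le> edge_weight e" for u p v
  proof (rule ccontr)
    assume "\<not> apath u p v"
    with p(1) have "\<not> distinct (awalk_verts u p)" by (simp add: apath_def)
    with awalk_not_distinct_decomp[OF p(1)] obtain q r s x where
      "p = q @ r @ s" "0 < length r" "awalk x r x" by blast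
    moreover from this p(2) have "0 \<le> sum_list (map edge_weight r)"
      by (intro sum_list_nonneg) auto
    ultimately show False using closed[of x r] by auto
  qed
  have dominate: "\<exists>q. awalk (\<sigma> 1) q v \<and> (\<forall>e\<in>set q. 0 \<le> edge_weight e) \<and>
      sum_list (map edge_weight p) \<le> sum_list (map edge_weight q)"
    if "awalk (\<sigma> 1) p v" for p v
  proof (rule forward_awalk_dominates[OF _ _ _ _ that])
    fix u p assume "awalk u p u" "p \<noteq> []"
    then show "sum_list (map edge_weight p) \<le> - 1" by (rule closed)
  next
    fix u v assume "u \<in> verts (digraph_of n D)" "v \<in> verts (digraph_of n D)" "u \<noteq> v"
    then obtain a b where ab: "a \<in> {1..n}" "b \<in> {1..n}" "u = \<sigma> a" "v = \<sigma> b" "a \<noteq> b"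
      using permutes_image[OF perm] by (metis digraph_of_simps(1) imageE)
    then show "\<exists>e\<in>arcs (digraph_of n D). 0 \<le> edge_weight e \<and>
        (tail (digraph_of n D) e = u \<and> head (digraph_of n D) e = v \<or>
         tail (digraph_of n D) e = v \<and> head (digraph_of n D) e = u)"
      using forward[of a b] forward[of b a] by (cases "a < b") auto
  next
    fix v assume v: "v \<in> verts (digraph_of n D)" "v \<noteq> \<sigma> 1"
    then obtain b where b: "b \<in> {1..n}" "v = \<sigma> b"
      using permutes_image[OF perm] by (metis digraph_of_simps(1) imageE)
    with v have "1 < b" by (cases "b = 1") auto
    with b show "\<exists>e\<in>arcs (digraph_of n D). 0 \<le> edge_weight e \<and>
        tail (digraph_of n D) e = \<sigma> 1 \<and> head (digraph_of n D) e = v"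
      using forward[of 1 b] by auto
  next
    fix e f h
    assume edges: "e \<in> arcs (digraph_of n D)" "f \<in> arcs (digraph_of n D)" "h \<in> arcs (digraph_of n D)"
      "tail (digraph_of n D) e = tail (digraph_of n D) h"
      "head (digraph_of n D) e = tail (digraph_of n D) f"
      "head (digraph_of n D) f = head (digraph_of n D) h"
      and nonneg: "0 \<le> edge_weight e" "0 \<le> edge_weight f"
    then obtain x a y b z c where efh: "e = (x, a, y)" "f = (y, b, z)" "h = (x, c, z)"
      by (cases e; cases f; cases h) auto
    from efh edges have D: "(x, a, y) \<in> D" "(y, b, z) \<in> D" "(x, c, z) \<in> D"
      and eq: "edge_weight e = a" "edge_weight f = b" "edge_weight h = c"
      by (simp_all add: edge_weight_def)
    note val = valid_w_edge[OF assms(5)]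
    have "w D x z \<le> w D x y + w D y z + 1"
    proof -
      have "0 \<le> w D x y" "0 \<le> w D y z" using val[OF D(1)] val[OF D(2)] nonneg eq by simp_all
      with assms(4-6) valid_edge_ends[OF assms(5) D(1)] valid_edge_ends[OF assms(5) D(2)]
        valid_edge_ends[OF assms(5) D(3)]
      show ?thesis unfolding weak_triangle_inequality_def by blast
    qed
    with val[OF D(1)] val[OF D(2)] val[OF D(3)] eq
    show "edge_weight h \<le> edge_weight e + edge_weight f + 1" by (simp add: one_ereal_def)
  qed
  define S where "S v = {total_weight p | p. apath (\<sigma> 1) p v}" for v
  have fin: "finite (S v)" for v
    unfolding S_def using apaths_finite[of "\<sigma> 1" v] by (simp add: setcompr_eq_image)
  have g: "gain n D \<sigma> v = Max (S v)" for v by (simp add: gain_def S_def)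
  have "S (\<sigma> 1) = {0}"
  proof -
    have "\<sigma> 1 \<in> {1..n}" using permutes_in_image[OF perm, of 1] assms(8,9) by simp
    then have "apath (\<sigma> 1) [] (\<sigma> 1)" by (simp add: apath_Nil_iff)
    moreover have "p = []" if "apath (\<sigma> 1) p (\<sigma> 1)" for p
      using apath_nonempty_ends[OF that] by blast
    ultimately show ?thesis unfolding S_def by (force simp: total_weight_def)
  qed
  then have g1: "gain n D \<sigma> (\<sigma> 1) = 0" by (simp add: g)
  from forward[of 1 i] assms(8,9) obtain e where
    e: "e \<in> D" "0 \<le> edge_weight e" "fst e = \<sigma> 1" "snd (snd e) = \<sigma> i" by auto
  then have "awalk (\<sigma> 1) [e] (\<sigma> i)" using arc_implies_awalk[of e] by simp
  with e(2) have "apath (\<sigma> 1) [e] (\<sigma> i)" by (intro apath) auto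
  then have "S (\<sigma> i) \<noteq> {}" by (auto simp: S_def)
  from Max_in[OF fin this] obtain p where
    p: "apath (\<sigma> 1) p (\<sigma> i)" "total_weight p = gain n D \<sigma> (\<sigma> i)"
    by (auto simp: S_def g)
  from dominate[OF awalkI_apath[OF p(1)]] obtain q where
    q: "awalk (\<sigma> 1) q (\<sigma> i)" "\<forall>e\<in>set q. 0 \<le> edge_weight e" "total_weight p \<le> total_weight q"
    by (auto simp: total_weight_def)
  have "total_weight q \<le> gain n D \<sigma> (\<sigma> i)"
    unfolding g using apath[OF q(1,2)] by (intro Max_ge[OF fin]) (auto simp: S_def)
  with p(2) q(3) have "total_weight q = gain n D \<sigma> (\<sigma> i) - gain n D \<sigma> (\<sigma> 1)"
    using g1 by linarith
  with apath[OF q(1,2)] q(2) show ?thesis by blast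
qed

end
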